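(* Let $\Lambda:H^\infty_1\to\mathbb{C}$ be a non-zero multiplicative linear functional satisfying $\Lambda(z^2)\in\mathbb{D}$. Then there exists $w\in\mathbb{D}$ such that $\Lambda(f)=f(w)$ for all $f\in H^\infty_1$.
   Context: $\mathbb{D}$ is the open unit disc in $\mathbb{C}$, $H^\infty$ is the algebra of bounded analytic functions on $\mathbb{D}$, and $H^\infty_1=\{f\in H^\infty: f'(0)=0\}$, a subalgebra of $H^\infty$. $z^2$ denotes the function $z\mapsto z^2$. A linear functional $\Lambda$ is multiplicative if $\Lambda(fg)=\Lambda(f)\Lambda(g)$ for all $f,g$ in its domain; no continuity is assumed. *)

theory Defs
  imports "HOL-Complex_Analysis.Complex_Analysis"
begin

abbreviation unit_disc :: "complex set" where
  "unit_disc \<equiv> ball 0 1"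

(* A function on the disc is represented by its extension by 0 to the whole plane,
   so that two elements of Hinf are equal exactly when they agree on the disc, and
   the pointwise operations on total functions are those of the algebra. *)
definition on_disc :: "(complex \<Rightarrow> complex) \<Rightarrow> complex \<Rightarrow> complex" where
  "on_disc f = (\<lambda>z. if z \<in> unit_disc then f z else 0)"

definition Hinf :: "(complex \<Rightarrow> complex) set" where
  "Hinf = {f. f holomorphic_on unit_disc \<and> bounded (f ` unit_disc) \<and>
              (\<forall>z. z \<notin> unit_disc \<longrightarrow> f z = 0)}"

definition Hinf1 :: "(complex \<Rightarrow> complex) set" where
  "Hinf1 = {f \<in> Hinf. deriv f 0 = 0}"

(* The domain is a set A of functions closed under the pointwise operations;
   the values of \<Lambda> outside A are irrelevant. *)
definition linear_functional_on ::
  "(complex \<Rightarrow> complex) set \<Rightarrow> ((complex \<Rightarrow> complex) \<Rightarrow> complex) \<Rightarrow> bool" where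
  "linear_functional_on A \<Lambda> \<longleftrightarrow>
     (\<forall>f\<in>A. \<forall>g\<in>A. \<Lambda> (\<lambda>z. f z + g z) = \<Lambda> f + \<Lambda> g) \<and>
     (\<forall>c. \<forall>f\<in>A. \<Lambda> (\<lambda>z. c * f z) = c * \<Lambda> f)"

definition multiplicative_on ::
  "(complex \<Rightarrow> complex) set \<Rightarrow> ((complex \<Rightarrow> complex) \<Rightarrow> complex) \<Rightarrow> bool" where
  "multiplicative_on A \<Lambda> \<longleftrightarrow> (\<forall>f\<in>A. \<forall>g\<in>A. \<Lambda> (\<lambda>z. f z * g z) = \<Lambda> f * \<Lambda> g)"

lemma Hinf1_differentiable:
  assumes "f \<in> Hinf1" shows "f field_differentiable at 0"
proof -
  have "f holomorphic_on unit_disc"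
    using assms by (simp add: Hinf1_def Hinf_def)
  then show ?thesis
    by (rule holomorphic_on_imp_differentiable_at) simp_all
qed

lemma Hinf1_add:
  assumes "f \<in> Hinf1" "g \<in> Hinf1" shows "(\<lambda>z. f z + g z) \<in> Hinf1"
proof -
  have "bounded ((\<lambda>z. f z + g z) ` unit_disc)"
    by (rule bounded_plus_comp) (use assms in \<open>simp_all add: Hinf1_def Hinf_def\<close>)
  then show ?thesis
    using assms Hinf1_differentiable[OF assms(1)] Hinf1_differentiable[OF assms(2)]
    by (simp add: Hinf1_def Hinf_def holomorphic_on_add)
qed

lemma Hinf1_mult:
  assumes "f \<in> Hinf1" "g \<in> Hinf1" shows "(\<lambda>z. f z * g z) \<in> Hinf1"
proof -
  have "bounded (f ` unit_disc)" "bounded (g ` unit_disc)"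
    using assms by (simp_all add: Hinf1_def Hinf_def)
  then obtain B C where BC: "\<forall>y\<in>f ` unit_disc. norm y \<le> B" "\<forall>y\<in>g ` unit_disc. norm y \<le> C"
    unfolding bounded_iff by blast
  have "norm (f z * g z) \<le> B * C" if "z \<in> unit_disc" for z
  proof -
    have "norm (f z) \<le> B" "norm (g z) \<le> C"
      using BC that by blast+
    then show ?thesis
      unfolding norm_mult using norm_ge_zero[of "f z"]
      by (intro mult_mono) (use norm_ge_zero[of "g z"] in linarith)+
  qed
  then have "bounded ((\<lambda>z. f z * g z) ` unit_disc)"
    unfolding bounded_iff by blast
  then show ?thesis
    using assms Hinf1_differentiable[OF assms(1)] Hinf1_differentiable[OF assms(2)]
    by (simp add: Hinf1_def Hinf_def holomorphic_on_mult)
qed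

lemma on_disc_Hinf1:
  assumes "f holomorphic_on unit_disc" "bounded (f ` unit_disc)" "deriv f 0 = 0"
  shows "on_disc f \<in> Hinf1"
proof -
  have "deriv (on_disc f) 0 = deriv f 0"
    by (rule deriv_cong_ev)
      (auto simp: on_disc_def eventually_nhds intro!: exI[of _ "unit_disc"])
  moreover have "on_disc f holomorphic_on unit_disc"
    using assms(1) by (rule holomorphic_transform) (simp add: on_disc_def)
  moreover have "on_disc f ` unit_disc = f ` unit_disc"
    by (simp add: on_disc_def)
  ultimately show ?thesis
    using assms by (auto simp: Hinf1_def Hinf_def on_disc_def)
qed

lemma Hinf1_const: "on_disc (\<lambda>_. c) \<in> Hinf1"
  by (intro on_disc_Hinf1) (auto intro: bounded_subset[of "{c}"])

lemma Hinf1_cmult: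
  assumes "f \<in> Hinf1" shows "(\<lambda>z. c * f z) \<in> Hinf1"
proof -
  have "(\<lambda>z. c * f z) = (\<lambda>z. on_disc (\<lambda>_. c) z * f z)"
    using assms by (auto simp: on_disc_def Hinf1_def Hinf_def)
  then show ?thesis
    using Hinf1_mult[OF Hinf1_const assms] by simp
qed

lemma Hinf1_square: "on_disc (\<lambda>z. z ^ 2) \<in> Hinf1"
proof (rule on_disc_Hinf1)
  show "bounded ((\<lambda>z::complex. z ^ 2) ` unit_disc)"
    unfolding bounded_iff by (auto intro!: exI[of _ 1] simp: norm_power power_le_one)
  have "((\<lambda>z::complex. z ^ 2) has_field_derivative 0) (at 0)"
    by (auto intro!: derivative_eq_intros)
  then show "deriv (\<lambda>z::complex. z ^ 2) 0 = 0"
    by (rule DERIV_imp_deriv)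
qed (auto intro!: holomorphic_intros)

end

theory Submission
  imports Defs
begin

text \<open>Choose \<open>w\<close> with \<open>w\<^sup>2 = \<Lambda>(z\<^sup>2)\<close> and \<open>w\<^sup>3 = \<Lambda>(z\<^sup>3)\<close>. Any \<open>g\<close> in
  \<open>Hinf1\<close> with \<open>g(w) = 0\<close> is \<open>(z - w)h\<close> with \<open>h\<close> bounded analytic, so
  \<open>z\<^sup>4g = (z\<^sup>3 - w z\<^sup>2)(z\<^sup>2h)\<close> is a product in \<open>Hinf1\<close> whose first factor is annihilated by
  \<open>\<Lambda>\<close>; this gives \<open>\<Lambda>(g) = 0\<close> if \<open>w \<noteq> 0\<close>. If \<open>w = 0\<close>, then \<open>g = z\<^sup>2h\<close> and
  \<open>g\<^sup>2 = z\<^sup>2(z\<^sup>2h\<^sup>2)\<close> is annihilated.\<close>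

lemma Hinf_mult:
  assumes "f \<in> Hinf" "g \<in> Hinf" shows "(\<lambda>z. f z * g z) \<in> Hinf"
proof -
  obtain B C where BC: "\<forall>y\<in>f ` unit_disc. norm y \<le> B" "\<forall>y\<in>g ` unit_disc. norm y \<le> C"
    using assms unfolding Hinf_def bounded_iff by blast
  have "norm (f z * g z) \<le> B * C" if "z \<in> unit_disc" for z
  proof -
    have "norm (f z) \<le> B" "norm (g z) \<le> C"
      using BC that by blast+
    then show ?thesis
      unfolding norm_mult by (intro mult_mono) (auto intro: order_trans[OF norm_ge_zero])
  qed
  then have "bounded ((\<lambda>z. f z * g z) ` unit_disc)"
    unfolding bounded_iff by blast
  then show ?thesis
    using assms by (simp add: Hinf_def holomorphic_on_mult)
qed

lemma Hinf_field_differentiable: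
  assumes "f \<in> Hinf" "z \<in> unit_disc" shows "f field_differentiable at z"
  using assms by (intro holomorphic_on_imp_differentiable_at[of f unit_disc]) (auto simp: Hinf_def)

text \<open>The double zero of z^2 at 0 forces derivative 0 whatever \<open>h\<close> is. Quotients
  obtained by dividing out zeros need not lie in \<open>Hinf1\<close>; this factor brings them back
  into the domain of \<Lambda>.\<close>

lemma square_mult_Hinf1:
  assumes "h \<in> Hinf" shows "(\<lambda>z. z ^ 2 * h z) \<in> Hinf1"
proof -
  have eq: "(\<lambda>z. z ^ 2 * h z) = (\<lambda>z. on_disc (\<lambda>z. z ^ 2) z * h z)"
    using assms by (auto simp: on_disc_def Hinf_def)
  have "(\<lambda>z. z ^ 2 * h z) \<in> Hinf"
    unfolding eq using Hinf1_square assms by (intro Hinf_mult) (auto simp: Hinf1_def)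
  moreover have "(h has_field_derivative deriv h 0) (at 0)"
    using Hinf_field_differentiable[OF assms, of 0] field_differentiable_derivI by auto
  then have "((\<lambda>z. z ^ 2 * h z) has_field_derivative 0) (at 0)"
    by (auto intro!: derivative_eq_intros)
  then have "deriv (\<lambda>z. z ^ 2 * h z) 0 = 0"
    by (rule DERIV_imp_deriv)
  ultimately show ?thesis
    by (simp add: Hinf1_def)
qed

text \<open>The difference quotient at \<open>w\<close> has a removable singularity. It is bounded
  near \<open>w\<close> by compactness of a small closed disc, and away from \<open>w\<close>
  because the denominator is at least the radius of that disc.\<close>

lemma Hinf_factor_zero:
  assumes f: "f \<in> Hinf" and w: "w \<in> unit_disc" "f w = 0"
  obtains h where "h \<in> Hinf" "\<And>z. f z = (z - w) * h z"
proof -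
  define q where "q = (\<lambda>z. if z = w then deriv f w else (f z - f w) / (z - w))"
  have holf: "f holomorphic_on unit_disc"
    using f by (simp add: Hinf_def)
  have holq: "q holomorphic_on unit_disc"
    unfolding q_def using holf w by (intro pole_lemma) (auto simp: interior_open)
  have fq: "f z = (z - w) * q z" for z
    using w by (auto simp: q_def)
  obtain r where r: "r > 0" "cball w r \<subseteq> unit_disc"
    using open_contains_cball_eq[OF open_ball] w(1) by blast
  have "compact (q ` cball w r)"
    using r by (intro compact_continuous_image compact_cball
        holomorphic_on_imp_continuous_on[OF holomorphic_on_subset[OF holq]])
  then obtain C where C: "\<And>z. z \<in> cball w r \<Longrightarrow> norm (q z) \<le> C"
    by (meson compact_imp_bounded bounded_iff imageI)
  obtain B where B: "\<And>z. z \<in> unit_disc \<Longrightarrow> norm (f z) \<le> B"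
    using f unfolding Hinf_def bounded_iff by blast
  have "norm (q z) \<le> max C (B / r)" if z: "z \<in> unit_disc" for z
  proof (cases "z \<in> cball w r")
    case True
    then show ?thesis using C[OF True] by simp
  next
    case False
    then have far: "norm (z - w) > r"
      by (simp add: dist_norm norm_minus_commute)
    have "q z = f z / (z - w)"
      using far r w by (auto simp: q_def)
    then have "norm (q z) = norm (f z) / norm (z - w)"
      by (simp add: norm_divide)
    also have "\<dots> \<le> B / r"
      using order_trans[OF norm_ge_zero B[OF z]] B[OF z] far r by (intro frac_le) simp_all
    finally show ?thesis by simp
  qed
  then have "bounded (q ` unit_disc)"
    unfolding bounded_iff by blast
  moreover have "on_disc q holomorphic_on unit_disc"
    using holq by (rule holomorphic_transform) (simp add: on_disc_def)
  moreover have "on_disc q ` unit_disc = q ` unit_disc"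
    by (simp add: on_disc_def)
  moreover have "on_disc q z = 0" if "z \<notin> unit_disc" for z
    using that by (simp add: on_disc_def)
  ultimately have "on_disc q \<in> Hinf"
    by (simp only: Hinf_def mem_Collect_eq) blast
  moreover have "f z = (z - w) * on_disc q z" for z
    using fq[of z] f by (auto simp: on_disc_def Hinf_def)
  ultimately show ?thesis
    by (rule that)
qed

text \<open>After dividing by z once, the quotient takes the value f'(0) = 0 at 0, so z can be
  divided out again.\<close>

lemma Hinf1_factor_square:
  assumes f: "f \<in> Hinf1" and "f 0 = 0"
  obtains h where "h \<in> Hinf" "\<And>z. f z = z ^ 2 * h z"
proof -
  obtain k where k: "k \<in> Hinf" "\<And>z. f z = z * k z"
    using Hinf_factor_zero[of f 0] assms by (auto simp: Hinf1_def)
  have "(k has_field_derivative deriv k 0) (at 0)"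
    using Hinf_field_differentiable[OF k(1), of 0] field_differentiable_derivI by auto
  then have "((\<lambda>z. z * k z) has_field_derivative k 0) (at 0)"
    by (auto intro!: derivative_eq_intros)
  moreover have "f = (\<lambda>z. z * k z)"
    using k by auto
  ultimately have "k 0 = 0"
    using f DERIV_imp_deriv by (force simp: Hinf1_def)
  then obtain h where "h \<in> Hinf" "\<And>z. k z = z * h z"
    using Hinf_factor_zero[of k 0] k by auto
  then show ?thesis
    using that[of h] k by (simp add: power2_eq_square mult.assoc)
qed

theorem theorem3p4:
  fixes \<Lambda> :: "(complex \<Rightarrow> complex) \<Rightarrow> complex"
  assumes "linear_functional_on Hinf1 \<Lambda>"
    and "multiplicative_on Hinf1 \<Lambda>"
    and "\<exists>f\<in>Hinf1. \<Lambda> f \<noteq> 0"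
    and "\<Lambda> (on_disc (\<lambda>z. z ^ 2)) \<in> unit_disc"
  shows "\<exists>w\<in>unit_disc. \<forall>f\<in>Hinf1. \<Lambda> f = f w"
proof -
  have add: "\<Lambda> (\<lambda>z. f z + g z) = \<Lambda> f + \<Lambda> g" if "f \<in> Hinf1" "g \<in> Hinf1" for f g
    using assms(1) that by (simp add: linear_functional_on_def)
  have scale: "\<Lambda> (\<lambda>z. c * f z) = c * \<Lambda> f" if "f \<in> Hinf1" for c f
    using assms(1) that by (simp add: linear_functional_on_def)
  have mult: "\<Lambda> (\<lambda>z. f z * g z) = \<Lambda> f * \<Lambda> g" if "f \<in> Hinf1" "g \<in> Hinf1" for f g
    using assms(2) that by (simp add: multiplicative_on_def)
  define e where "e = (\<lambda>n::nat. on_disc (\<lambda>z. z ^ n))"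
  have e0: "e 0 \<in> Hinf1" and e2: "e 2 \<in> Hinf1"
    using Hinf1_const[of 1] Hinf1_square by (simp_all add: e_def)
  \<comment> \<open>The function z has derivative 1 at 0 and so lies outside \<open>Hinf1\<close>;
    it serves only as the cofactor in z^3 = z^2 z.\<close>
  have "e 1 \<in> Hinf"
  proof -
    have "bounded (e 1 ` unit_disc)"
      by (rule bounded_subset[of unit_disc]) (auto simp: e_def on_disc_def)
    moreover have "e 1 holomorphic_on unit_disc"
      by (rule holomorphic_transform[of "\<lambda>z. z"]) (auto simp: e_def on_disc_def)
    ultimately show ?thesis
      by (simp add: Hinf_def e_def on_disc_def)
  qed
  moreover have "e 3 = (\<lambda>z. z ^ 2 * e 1 z)"
    by (auto simp: e_def on_disc_def power3_eq_cube power2_eq_square)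
  ultimately have e3: "e 3 \<in> Hinf1"
    using square_mult_Hinf1[of "e 1"] by simp
  have one: "\<Lambda> (e 0) = 1"
  proof -
    obtain f where f: "f \<in> Hinf1" "\<Lambda> f \<noteq> 0"
      using assms(3) by blast
    then have "(\<lambda>z. f z * e 0 z) = f"
      by (auto simp: e_def on_disc_def Hinf1_def Hinf_def)
    then show ?thesis
      using mult[OF f(1) e0] f by simp
  qed
  define s t where "s = \<Lambda> (e 2)" and "t = \<Lambda> (e 3)"
  \<comment> \<open>The identity (z^3)^2 = (z^2)^3 puts (s, t) on the cuspidal cubic t^2 = s^3,
    which w \<mapsto> (w^2, w^3) parametrises.\<close>
  have "(\<lambda>z. e 3 z * e 3 z) = (\<lambda>z. e 2 z * (e 2 z * e 2 z))"
    by (auto simp: e_def on_disc_def simp flip: power_add)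
  then have st: "t * t = s * (s * s)"
    unfolding s_def t_def using mult e2 e3 Hinf1_mult[OF e2 e2] by metis
  \<comment> \<open>At the cusp s = 0 the cubic relation gives t = 0, and division by zero yields
    \<open>w = 0\<close>, so both equations below hold there too.\<close>
  define w where "w = t / s"
  have ws: "w * w = s" and wt: "w * s = t"
    using st by (auto simp: w_def divide_simps)
  have "norm s < 1"
    using assms(4) by (simp add: s_def e_def)
  then have "norm w * norm w < 1"
    using ws by (metis norm_mult)
  then have w: "w \<in> unit_disc"
    using mult_mono[of 1 "norm w" 1 "norm w"] by (force simp: not_less)
  have kernel: "\<Lambda> g = 0" if g: "g \<in> Hinf1" "g w = 0" for g
  proof (cases "s = 0")
    case True
    then obtain h where h: "h \<in> Hinf" "\<And>z. g z = z ^ 2 * h z"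
      using Hinf1_factor_square[of g] g by (auto simp: w_def)
    \<comment> \<open>Since \<open>h\<close> may lie outside \<open>Hinf1\<close>, multiplicativity
      does not apply to g = z^2 h itself. Squaring g leaves a spare z^2 to attach to h^2.\<close>
    have hh: "(\<lambda>z. z ^ 2 * (h z * h z)) \<in> Hinf1"
      using h by (intro square_mult_Hinf1 Hinf_mult)
    have "(\<lambda>z. g z * g z) = (\<lambda>z. e 2 z * (z ^ 2 * (h z * h z)))"
      using h by (auto simp: e_def on_disc_def Hinf_def algebra_simps)
    then have "\<Lambda> g * \<Lambda> g = s * \<Lambda> (\<lambda>z. z ^ 2 * (h z * h z))"
      using mult[OF g(1) g(1)] mult[OF e2 hh] by (simp add: s_def)
    then show ?thesis
      using True by simp
  next
    case False
    obtain h where h: "h \<in> Hinf" "\<And>z. g z = (z - w) * h z"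
      using Hinf_factor_zero[of g w] g w by (auto simp: Hinf1_def)
    \<comment> \<open>On the disc p = z^2 (z - w). Both z - w and \<open>h\<close> may fall outside
      \<open>Hinf1\<close>, so each needs its own factor z^2; hence g is multiplied by z^4.\<close>
    define p where "p = (\<lambda>z. e 3 z + (- w) * e 2 z)"
    have p: "p \<in> Hinf1"
      unfolding p_def by (intro Hinf1_add Hinf1_cmult e2 e3)
    have "\<Lambda> p = 0"
      unfolding p_def add[OF e3 Hinf1_cmult[OF e2]] scale[OF e2]
      using wt by (simp add: s_def t_def)
    moreover have "(\<lambda>z. e 2 z * (e 2 z * g z)) = (\<lambda>z. p z * (z ^ 2 * h z))"
      by (rule ext) (simp add: h(2) p_def e_def on_disc_def power2_eq_square power3_eq_cube
        left_diff_distrib right_diff_distrib mult_ac)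
    ultimately have "s * (s * \<Lambda> g) = 0"
      using mult[OF e2 Hinf1_mult[OF e2 g(1)]] mult[OF e2 g(1)]
        mult[OF p square_mult_Hinf1[OF h(1)]] by (simp add: s_def)
    then show ?thesis
      using False by simp
  qed
  have "\<Lambda> f = f w" if f: "f \<in> Hinf1" for f
  proof -
    \<comment> \<open>Subtracting the constant f(w) produces a function vanishing at
      \<open>w\<close>; \<Lambda> sends that constant to f(w) by \<open>one\<close>.\<close>
    have "\<Lambda> (\<lambda>z. f z + (- f w) * e 0 z) = 0"
      using w by (intro kernel Hinf1_add Hinf1_cmult f e0) (simp add: e_def on_disc_def)
    then show ?thesis
      unfolding add[OF f Hinf1_cmult[OF e0]] scale[OF e0] one by simp
  qed
  then show ?thesis
    using w by blast
qed

end
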